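(* For each $n\in\mathbb N$ there exist unique polynomials $\Phi_n(X_0,X_1,X_2;X)$ and $\Psi_n(X_0,X_1,X_2;X)$ over $\mathbb Z$ satisfying $$ \Phi_n(\phi_m^{(0)},\phi_m^{(1)},\phi_m^{(2)};\psi_m)=\phi_{mn},\qquad \Psi_n(\phi_m^{(0)},\phi_m^{(1)},\phi_m^{(2)};\psi_m)=\psi_{mn}\qquad\text{for all } m\in\mathbb N . $$
   Context: $\mathbb N$ is the set of nonnegative integers. $T_n(X)$ ($n\in\mathbb N$) are the normalized Chebyshev polynomials of the first kind over $\mathbb Z$: $T_0(X)=2$, $T_1(X)=X$, $T_{n+1}(X)=XT_n(X)-T_{n-1}(X)$ for $n\ge1$. For $n\in\mathbb N$ and $i\in\mathbb Z/3\mathbb Z$ (indices of $X_j$ read mod 3) define polynomials in the commuting variables $X_0,X_1,X_2,X$: $\phi_n^{(i)}=T_n(X)T_n(X_i)+T_n(X_{i+1})T_n(X_{i+2})$, $\phi_n=\phi_n^{(0)}$, and $\psi_n=T_{2n}(X)+T_n(X_0)^2+T_n(X_1)^2+T_n(X_2)^2+T_n(X)T_n(X_0)T_n(X_1)T_n(X_2)$. *)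

theory Defs
  imports
    "HOL-Library.Poly_Mapping"
    "HOL-Library.Numeral_Type"
    "HOL-Computational_Algebra.Polynomial"
begin

text \<open>
  The numeral type \<open>3\<close> is \<open>\<int>/3\<int>\<close>, with arithmetic modulo 3.  A monomial is a finitely supported
  exponent map, and a polynomial a finitely supported map from monomials to coefficients, whose
  product in \<^theory>\<open>HOL-Library.Poly_Mapping\<close> is convolution.
\<close>

datatype indet = Xi "3" | X

type_synonym 'v int_mpoly = "('v \<Rightarrow>\<^sub>0 nat) \<Rightarrow>\<^sub>0 int"

definition var :: "'v \<Rightarrow> 'v int_mpoly"
  where "var v = Poly_Mapping.single (Poly_Mapping.single v 1) 1"

definition mpoly_subst :: "('v \<Rightarrow> 'a::comm_ring_1) \<Rightarrow> 'v int_mpoly \<Rightarrow> 'a"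
  where "mpoly_subst \<sigma> p =
    (\<Sum>t\<in>Poly_Mapping.keys p. of_int (Poly_Mapping.lookup p t) *
      (\<Prod>v\<in>Poly_Mapping.keys t. \<sigma> v ^ Poly_Mapping.lookup t v))"

definition eval4 :: "indet int_mpoly \<Rightarrow> 'a::comm_ring_1 \<Rightarrow> 'a \<Rightarrow> 'a \<Rightarrow> 'a \<Rightarrow> 'a"
  where "eval4 P a0 a1 a2 b =
    mpoly_subst (\<lambda>v. case v of Xi i \<Rightarrow> if i = 0 then a0 else if i = 1 then a1 else a2 | X \<Rightarrow> b) P"

fun chebT :: "nat \<Rightarrow> int poly" where
  "chebT 0 = [:2:]"
| "chebT (Suc 0) = [:0, 1:]"
| "chebT (Suc (Suc n)) = [:0, 1:] * chebT (Suc n) - chebT n"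

definition chebT_at :: "nat \<Rightarrow> 'a::comm_ring_1 \<Rightarrow> 'a"
  where "chebT_at n a = poly (map_poly of_int (chebT n)) a"

definition phi :: "nat \<Rightarrow> 3 \<Rightarrow> indet int_mpoly"
  where "phi n i =
    chebT_at n (var X) * chebT_at n (var (Xi i))
    + chebT_at n (var (Xi (i + 1))) * chebT_at n (var (Xi (i + 2)))"

definition psi :: "nat \<Rightarrow> indet int_mpoly"
  where "psi n =
    chebT_at (2 * n) (var X)
    + chebT_at n (var (Xi 0)) ^ 2 + chebT_at n (var (Xi 1)) ^ 2 + chebT_at n (var (Xi 2)) ^ 2
    + chebT_at n (var X) * chebT_at n (var (Xi 0)) * chebT_at n (var (Xi 1))
      * chebT_at n (var (Xi 2))"

end

theory Submission
  imports Defs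
begin

text \<open>
  Put \<open>X = x + x\<^sup>-\<^sup>1\<close> and \<open>X\<^sub>i = x\<^sub>i + x\<^sub>i\<^sup>-\<^sup>1\<close>.  Then \<open>\<phi>\<^sub>n\<close> is the \<open>n\<close>th power sum of the eight quantities
  \<open>(x x\<^sub>0)\<^sup>\<plusminus>\<^sup>1\<close>, \<open>(x / x\<^sub>0)\<^sup>\<plusminus>\<^sup>1\<close>, \<open>(x\<^sub>1 x\<^sub>2)\<^sup>\<plusminus>\<^sup>1\<close>, \<open>(x\<^sub>1 / x\<^sub>2)\<^sup>\<plusminus>\<^sup>1\<close> (the weights of the vector representation of
  type \<open>D\<^sub>4\<close>), and their elementary symmetric functions \<open>\<phi>\<^sub>1\<close>, \<open>\<psi>\<^sub>1 - 2\<close>,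
  \<open>\<phi>\<^sub>1\<^sup>(\<^sup>1\<^sup>) \<phi>\<^sub>1\<^sup>(\<^sup>2\<^sup>) - \<phi>\<^sub>1\<close>, \<open>(\<phi>\<^sub>1\<^sup>(\<^sup>1\<^sup>))\<^sup>2 + (\<phi>\<^sub>1\<^sup>(\<^sup>2\<^sup>))\<^sup>2 - 2 \<psi>\<^sub>1 + 2\<close> are polynomials in the
  \<open>\<phi>\<^sub>1\<^sup>(\<^sup>i\<^sup>)\<close> and \<open>\<psi>\<^sub>1\<close>; the resulting linear recurrence of order 8 gives \<open>\<Phi>\<^sub>n\<close>.  Comparing leading terms in
  \<open>X\<close> shows that \<open>\<phi>\<^sub>1\<^sup>(\<^sup>0\<^sup>)\<close>, \<open>\<phi>\<^sub>1\<^sup>(\<^sup>1\<^sup>)\<close>, \<open>\<phi>\<^sub>1\<^sup>(\<^sup>2\<^sup>)\<close>, \<open>\<psi>\<^sub>1\<close> are algebraically independent, even modulo every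
  integer \<open>d\<close>.  The case \<open>d = 0\<close> is uniqueness.  By the case \<open>d = 2\<close> the identity
  \<open>2 (\<psi>\<^sub>n - 2) = \<phi>\<^sub>n\<^sup>2 - \<phi>\<^sub>2\<^sub>n\<close> may be divided by 2, so that \<open>\<Psi>\<^sub>n = (\<Phi>\<^sub>n\<^sup>2 - \<Phi>\<^sub>2\<^sub>n) / 2 + 2\<close>.
\<close>

section \<open>Substitution is a ring homomorphism\<close>

definition monom_subst :: "('v \<Rightarrow> 'a::comm_ring_1) \<Rightarrow> ('v \<Rightarrow>\<^sub>0 nat) \<Rightarrow> 'a"
  where "monom_subst \<sigma> t = (\<Prod>v\<in>Poly_Mapping.keys t. \<sigma> v ^ Poly_Mapping.lookup t v)"

lemma monom_subst_superset:
  assumes "finite A" "Poly_Mapping.keys t \<subseteq> A"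
  shows "monom_subst \<sigma> t = (\<Prod>v\<in>A. \<sigma> v ^ Poly_Mapping.lookup t v)"
  unfolding monom_subst_def using assms
  by (intro prod.mono_neutral_left) (auto simp: in_keys_iff)

lemma monom_subst_zero [simp]: "monom_subst \<sigma> 0 = 1"
  by (simp add: monom_subst_def)

lemma monom_subst_single [simp]: "monom_subst \<sigma> (Poly_Mapping.single v 1) = \<sigma> v"
  by (simp add: monom_subst_def)

lemma monom_subst_add: "monom_subst \<sigma> (s + t) = monom_subst \<sigma> s * monom_subst \<sigma> t"
proof -
  let ?A = "Poly_Mapping.keys s \<union> Poly_Mapping.keys t"
  have "monom_subst \<sigma> (s + t) = (\<Prod>v\<in>?A. \<sigma> v ^ Poly_Mapping.lookup (s + t) v)"
    by (rule monom_subst_superset) (use keys_add[of s t] in auto)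
  also have "\<dots> = (\<Prod>v\<in>?A. \<sigma> v ^ Poly_Mapping.lookup s v) * (\<Prod>v\<in>?A. \<sigma> v ^ Poly_Mapping.lookup t v)"
    by (simp add: lookup_add power_add prod.distrib)
  also have "\<dots> = monom_subst \<sigma> s * monom_subst \<sigma> t"
    by (simp add: monom_subst_superset[of ?A s] monom_subst_superset[of ?A t])
  finally show ?thesis .
qed

lemma mpoly_subst_superset:
  assumes "finite A" "Poly_Mapping.keys p \<subseteq> A"
  shows "mpoly_subst \<sigma> p = (\<Sum>t\<in>A. of_int (Poly_Mapping.lookup p t) * monom_subst \<sigma> t)"
  unfolding mpoly_subst_def monom_subst_def using assms
  by (intro sum.mono_neutral_left) (auto simp: in_keys_iff)

lemma mpoly_subst_zero [simp]: "mpoly_subst \<sigma> 0 = 0"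
  by (simp add: mpoly_subst_def)

lemma mpoly_subst_frag_of [simp]: "mpoly_subst \<sigma> (frag_of t) = monom_subst \<sigma> t"
  by (simp add: mpoly_subst_def monom_subst_def keys_frag_of frag_of_nonzero)

lemma one_eq_frag_of: "(1 :: 'v int_mpoly) = frag_of 0"
  by simp

lemma mpoly_subst_one [simp]: "mpoly_subst \<sigma> 1 = 1"
  by (simp only: one_eq_frag_of mpoly_subst_frag_of monom_subst_zero)

lemma mpoly_subst_var [simp]: "mpoly_subst \<sigma> (var v) = \<sigma> v"
  by (simp only: var_def mpoly_subst_frag_of monom_subst_single)

text \<open>Integer polynomials form the free abelian group on the monomials
  \<open>frag_of t\<close>. Differences are treated before sums because
  \<open>frag_induction\<close> asks for them.\<close>

lemma mpoly_subst_diff: "mpoly_subst \<sigma> (p - q) = mpoly_subst \<sigma> p - mpoly_subst \<sigma> q"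
proof -
  let ?A = "Poly_Mapping.keys p \<union> Poly_Mapping.keys q"
  have "mpoly_subst \<sigma> (p - q) = (\<Sum>t\<in>?A. of_int (Poly_Mapping.lookup (p - q) t) * monom_subst \<sigma> t)"
    by (rule mpoly_subst_superset) (use keys_diff[of p q] in auto)
  also have "\<dots> = (\<Sum>t\<in>?A. of_int (Poly_Mapping.lookup p t) * monom_subst \<sigma> t)
      - (\<Sum>t\<in>?A. of_int (Poly_Mapping.lookup q t) * monom_subst \<sigma> t)"
    by (simp add: lookup_minus sum_subtractf algebra_simps)
  also have "\<dots> = mpoly_subst \<sigma> p - mpoly_subst \<sigma> q"
    by (simp add: mpoly_subst_superset[of ?A p] mpoly_subst_superset[of ?A q])
  finally show ?thesis .
qed

lemma mpoly_subst_uminus: "mpoly_subst \<sigma> (- p) = - mpoly_subst \<sigma> p"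
  using mpoly_subst_diff[of \<sigma> 0 p] by simp

lemma mpoly_subst_add: "mpoly_subst \<sigma> (p + q) = mpoly_subst \<sigma> p + mpoly_subst \<sigma> q"
  using mpoly_subst_diff[of \<sigma> p "- q"] by (simp add: mpoly_subst_uminus)

text \<open>Both sides are additive in each factor, so two inductions reduce the claim to a pair of
  monomials, where it is \<open>monom_subst_add\<close>.\<close>

lemma mpoly_subst_mult: "mpoly_subst \<sigma> (p * q) = mpoly_subst \<sigma> p * mpoly_subst \<sigma> q"
proof -
  have monom: "mpoly_subst \<sigma> (frag_of s * q) = monom_subst \<sigma> s * mpoly_subst \<sigma> q" for s
    using subset_UNIV
  proof (induction q rule: frag_induction)
    case (one t)
    have "frag_of s * frag_of t = frag_of (s + t)"
      by (simp add: mult_single)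
    then show ?case
      by (simp only: mpoly_subst_frag_of monom_subst_add)
  qed (simp_all add: mpoly_subst_diff right_diff_distrib)
  show ?thesis
    using subset_UNIV
    by (induction p rule: frag_induction) (simp_all add: monom mpoly_subst_diff left_diff_distrib)
qed

lemma mpoly_subst_power: "mpoly_subst \<sigma> (p ^ k) = mpoly_subst \<sigma> p ^ k"
  by (induction k) (simp_all add: mpoly_subst_mult)

lemma mpoly_subst_of_nat [simp]: "mpoly_subst \<sigma> (of_nat k) = of_nat k"
  by (induction k) (simp_all add: mpoly_subst_add)

lemma mpoly_subst_numeral [simp]: "mpoly_subst \<sigma> (numeral k) = numeral k"
  using mpoly_subst_of_nat[of \<sigma> "numeral k"] by (simp del: mpoly_subst_of_nat)

lemma mpoly_subst_of_int [simp]: "mpoly_subst \<sigma> (of_int k) = of_int k"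
  by (cases k) (simp_all add: mpoly_subst_diff mpoly_subst_uminus mpoly_subst_add)

lemma mpoly_subst_sum: "mpoly_subst \<sigma> (sum f A) = (\<Sum>x\<in>A. mpoly_subst \<sigma> (f x))"
  by (induction A rule: infinite_finite_induct) (simp_all add: mpoly_subst_add)

lemma mpoly_subst_prod: "mpoly_subst \<sigma> (prod f A) = (\<Prod>x\<in>A. mpoly_subst \<sigma> (f x))"
  by (induction A rule: infinite_finite_induct) (simp_all add: mpoly_subst_mult)

lemmas mpoly_subst_hom = mpoly_subst_diff mpoly_subst_uminus mpoly_subst_add mpoly_subst_mult
  mpoly_subst_power

lemma mpoly_subst_compose:
  "mpoly_subst \<tau> (mpoly_subst \<sigma> p) = mpoly_subst (\<lambda>v. mpoly_subst \<tau> (\<sigma> v)) p"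
  by (subst (2 3) mpoly_subst_def) (simp add: mpoly_subst_sum mpoly_subst_prod mpoly_subst_hom)

text \<open>Names the assignment inside \<open>eval4\<close>, so that facts about
  \<open>mpoly_subst\<close> can be folded into facts about \<open>eval4\<close>.\<close>

definition indet_case4 :: "'a \<Rightarrow> 'a \<Rightarrow> 'a \<Rightarrow> 'a \<Rightarrow> indet \<Rightarrow> 'a" where
  "indet_case4 a0 a1 a2 b v =
    (case v of Xi i \<Rightarrow> if i = 0 then a0 else if i = 1 then a1 else a2 | X \<Rightarrow> b)"

lemma eval4_eq: "eval4 P a0 a1 a2 b = mpoly_subst (indet_case4 a0 a1 a2 b) P"
  by (simp add: eval4_def indet_case4_def[abs_def])

lemmas eval4_hom = mpoly_subst_hom[where \<sigma> = "indet_case4 a0 a1 a2 b" for a0 a1 a2 b,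
    folded eval4_eq]

lemma eval4_numeral [simp]: "eval4 (numeral k) a0 a1 a2 b = numeral k"
  by (simp add: eval4_eq)

lemma eval4_of_int [simp]: "eval4 (of_int k) a0 a1 a2 b = of_int k"
  by (simp add: eval4_eq)

lemma eval4_var [simp]:
  "eval4 (var (Xi 0)) a0 a1 a2 b = a0" "eval4 (var (Xi 1)) a0 a1 a2 b = a1"
  "eval4 (var (Xi 2)) a0 a1 a2 b = a2" "eval4 (var X) a0 a1 a2 b = b"
  by (simp_all add: eval4_eq indet_case4_def)

lemma mpoly_subst_eval4:
  "mpoly_subst \<tau> (eval4 P a0 a1 a2 b) =
    eval4 P (mpoly_subst \<tau> a0) (mpoly_subst \<tau> a1) (mpoly_subst \<tau> a2) (mpoly_subst \<tau> b)"
proof -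
  have "(\<lambda>v. mpoly_subst \<tau> (indet_case4 a0 a1 a2 b v)) =
      indet_case4 (mpoly_subst \<tau> a0) (mpoly_subst \<tau> a1) (mpoly_subst \<tau> a2) (mpoly_subst \<tau> b)"
    by (auto simp: indet_case4_def split: indet.splits)
  then show ?thesis
    by (simp add: eval4_eq mpoly_subst_compose)
qed

section \<open>Chebyshev polynomials\<close>

lemma chebT_at_0 [simp]: "chebT_at 0 a = 2"
  by (simp add: chebT_at_def map_poly_pCons)

lemma chebT_at_1 [simp]: "chebT_at (Suc 0) a = a"
  by (simp add: chebT_at_def map_poly_pCons)

lemma chebT_at_Suc_Suc:
  "chebT_at (Suc (Suc n)) a = a * chebT_at (Suc n) a - chebT_at n a"
proof -
  have diff: "map_poly of_int (p - q) = (map_poly of_int p - map_poly of_int q :: 'a poly)" for p q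
    by (rule poly_eqI) (simp add: coeff_map_poly)
  show ?thesis
    by (simp add: chebT_at_def diff map_poly_pCons)
qed

lemma mpoly_subst_chebT_at: "mpoly_subst \<tau> (chebT_at n a) = chebT_at n (mpoly_subst \<tau> a)"
  by (induction n rule: chebT.induct) (simp_all add: chebT_at_Suc_Suc mpoly_subst_hom)

text \<open>Since \<open>T\<^sub>n\<close> is \<open>x\<^sup>n + x\<^sup>-\<^sup>n\<close> at \<open>x + x\<^sup>-\<^sup>1\<close>, its even extension to integer indices satisfies the
  recurrence without boundary cases.\<close>
definition chebT_int :: "int \<Rightarrow> 'a::comm_ring_1 \<Rightarrow> 'a"
  where "chebT_int k a = chebT_at (nat \<bar>k\<bar>) a"

lemma chebT_int_of_nat: "chebT_int (int n) a = chebT_at n a"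
  by (simp add: chebT_int_def)

lemma chebT_int_uminus [simp]: "chebT_int (- k) a = chebT_int k a"
  by (simp add: chebT_int_def)

lemma chebT_int_0 [simp]: "chebT_int 0 a = 2"
  by (simp add: chebT_int_def)

lemma chebT_int_1 [simp]: "chebT_int 1 a = a"
  by (simp add: chebT_int_def)

lemma chebT_int_rec: "chebT_int (k + 2) a = a * chebT_int (k + 1) a - chebT_int k a"
proof -
  have nonneg: "chebT_int (int n + 2) a = a * chebT_int (int n + 1) a - chebT_int (int n) a" for n
    using chebT_at_Suc_Suc[of n a] by (simp add: chebT_int_def nat_add_distrib)
  \<comment> \<open>Replacing \<open>k\<close> by \<open>- k - 2\<close> preserves the recurrence
    and carries the third case to the first; at the fixed point \<open>- 1\<close> it reads
    \<open>a = a * 2 - a\<close>.\<close>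
  consider "k \<ge> 0" | "k = - 1" | "k \<le> - 2"
    by linarith
  then show ?thesis
  proof cases
    case 1
    then show ?thesis
      using nonneg[of "nat k"] by simp
  next
    case 3
    then show ?thesis
      using nonneg[of "nat (- k - 2)"] chebT_int_uminus[of "k + 2" a] chebT_int_uminus[of "k + 1" a]
      by (simp add: algebra_simps)
  qed simp
qed

text \<open>For \<open>a = x + 1/x\<close> this is the product of \<open>x^j + x^(-j)\<close> and
  \<open>x^n + x^(-n)\<close> multiplied out.\<close>

lemma chebT_int_add:
  "chebT_int (j + int n) a + chebT_int (j - int n) a = chebT_int j a * chebT_int (int n) a"
proof (induction n rule: chebT.induct)
  case 2
  show ?case
    using chebT_int_rec[of "j - 1" a] by (simp add: algebra_simps)
next
  case (3 n)
  have r: "chebT_int (j + int (Suc (Suc n))) a = a * chebT_int (j + int (Suc n)) a - chebT_int (j + int n) a"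
    "chebT_int (j - int n) a = a * chebT_int (j - int (Suc n)) a - chebT_int (j - int (Suc (Suc n))) a"
    "chebT_int (int (Suc (Suc n))) a = a * chebT_int (int (Suc n)) a - chebT_int (int n) a"
    using chebT_int_rec[of "j + int n" a] chebT_int_rec[of "j - int (Suc (Suc n))" a]
      chebT_int_rec[of "int n" a]
    by (simp_all add: algebra_simps)
  have "chebT_int (j + int (Suc (Suc n))) a + chebT_int (j - int (Suc (Suc n))) a =
      a * (chebT_int (j + int (Suc n)) a + chebT_int (j - int (Suc n)) a) -
      (chebT_int (j + int n) a + chebT_int (j - int n) a)"
    using r(1,2) by (simp add: algebra_simps)
  then show ?case
    unfolding 3 r(3) by (simp add: algebra_simps)
qed simp

lemma chebT_at_double: "chebT_at (2 * n) a = chebT_at n a ^ 2 - 2"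
  using chebT_int_add[of "int n" n a] chebT_int_of_nat[of "2 * n" a]
  by (simp add: chebT_int_of_nat power2_eq_square algebra_simps)

lemma chebT_at_chebT_at: "chebT_at n (chebT_at m a) = chebT_at (m * n) a"
proof (induction n rule: chebT.induct)
  case (3 n)
  \<comment> \<open>The product formula with \<open>j = m * (n + 1)\<close> and step
    \<open>m\<close> is the Chebyshev recurrence at the point \<open>chebT_at m a\<close>.\<close>
  have "chebT_at (m * Suc (Suc n)) a = chebT_at (m * Suc n) a * chebT_at m a - chebT_at (m * n) a"
    using chebT_int_add[of "int (m * Suc n)" m a] chebT_int_of_nat[of "m * n" a]
      chebT_int_of_nat[of "m * Suc (Suc n)" a] chebT_int_of_nat[of "m * Suc n" a]
    by (simp add: chebT_int_of_nat algebra_simps)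
  with 3 show ?case
    by (simp add: chebT_at_Suc_Suc algebra_simps)
qed simp_all

section \<open>The polynomials \<open>phi\<close> and \<open>psi\<close> under Chebyshev
  substitution\<close>

lemma phi_components:
  "phi n 0 = chebT_at n (var X) * chebT_at n (var (Xi 0)) + chebT_at n (var (Xi 1)) * chebT_at n (var (Xi 2))"
    (is "?A")
  "phi n 1 = chebT_at n (var X) * chebT_at n (var (Xi 1)) + chebT_at n (var (Xi 2)) * chebT_at n (var (Xi 0))"
    (is "?B")
  "phi n 2 = chebT_at n (var X) * chebT_at n (var (Xi 2)) + chebT_at n (var (Xi 0)) * chebT_at n (var (Xi 1))"
    (is "?C")
proof -
  have mod3: "1 + 1 = (2 :: 3)" "1 + 2 = (0 :: 3)" "2 + 1 = (0 :: 3)" "2 + 2 = (1 :: 3)"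
    by simp_all
  show "?A" "?B" "?C"
    by (simp_all only: phi_def mod3 add_0)
qed

lemma phi_1:
  "phi 1 0 = var X * var (Xi 0) + var (Xi 1) * var (Xi 2)"
  "phi 1 1 = var X * var (Xi 1) + var (Xi 2) * var (Xi 0)"
  "phi 1 2 = var X * var (Xi 2) + var (Xi 0) * var (Xi 1)"
  by (simp_all add: phi_components)

lemma psi_1:
  "psi 1 = var X ^ 2 - 2 + var (Xi 0) ^ 2 + var (Xi 1) ^ 2 + var (Xi 2) ^ 2 +
    var X * var (Xi 0) * var (Xi 1) * var (Xi 2)"
  using chebT_at_double[of 1 "var X"] by (simp add: psi_def)

lemma mpoly_subst_phi: "mpoly_subst (\<lambda>v. chebT_at m (var v)) (phi n i) = phi (m * n) i"
  by (simp add: phi_def mpoly_subst_hom mpoly_subst_chebT_at chebT_at_chebT_at)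

lemma mpoly_subst_psi: "mpoly_subst (\<lambda>v. chebT_at m (var v)) (psi n) = psi (m * n)"
  by (simp add: psi_def mpoly_subst_hom mpoly_subst_chebT_at chebT_at_chebT_at mult.left_commute)

section \<open>Divisibility of coefficients\<close>

text \<open>For \<open>d = 0\<close> both sides say that \<open>p\<close> vanishes, so one
  divisibility argument serves for injectivity as well.\<close>

lemma of_int_dvd_int_mpoly_iff:
  fixes p :: "'v int_mpoly"
  shows "of_int d dvd p \<longleftrightarrow> (\<forall>t. d dvd Poly_Mapping.lookup p t)"
proof -
  have lookup: "Poly_Mapping.lookup (of_int d * q) t = d * Poly_Mapping.lookup q t" for q t
    by (induction d rule: int_induct[of _ 0]) (simp_all add: lookup_add lookup_minus algebra_simps)
  show ?thesis
  proof
    assume r: "\<forall>t. d dvd Poly_Mapping.lookup p t"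
    have "p = of_int d * Poly_Mapping.map (\<lambda>c. c div d) p"
      by (rule poly_mapping_eqI) (use r in \<open>auto simp: lookup Poly_Mapping.map.rep_eq when_def\<close>)
    then show "of_int d dvd p" ..
  qed (auto simp: lookup)
qed

lemma int_mpoly_double_inject:
  fixes p q :: "'v int_mpoly"
  assumes "2 * p = 2 * q"
  shows "p = q"
proof (rule poly_mapping_eqI)
  fix t
  have "Poly_Mapping.lookup (p + p) t = Poly_Mapping.lookup (q + q) t"
    using assms by (simp only: mult_2)
  then show "Poly_Mapping.lookup p t = Poly_Mapping.lookup q t"
    unfolding lookup_add by simp
qed

section \<open>Formal leading coefficients of products and powers\<close>

lemma coeff_mult_bounded:
  fixes p q :: "'a::comm_semiring_1 poly"
  assumes "degree p \<le> m" "degree q \<le> n"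
  shows "coeff (p * q) (m + n) = coeff p m * coeff q n"
proof -
  have "coeff (p * q) (m + n) = (\<Sum>i\<le>m + n. coeff p i * coeff q (m + n - i))"
    by (simp add: coeff_mult)
  also have "\<dots> = (\<Sum>i\<in>{m}. coeff p i * coeff q (m + n - i))"
  proof (rule sum.mono_neutral_right)
    show "\<forall>i\<in>{..m + n} - {m}. coeff p i * coeff q (m + n - i) = 0"
    proof
      fix i
      assume "i \<in> {..m + n} - {m}"
      then have "i > m \<or> m + n - i > n"
        by auto
      then show "coeff p i * coeff q (m + n - i) = 0"
        using assms by (auto simp: coeff_eq_0)
    qed
  qed auto
  finally show ?thesis
    by simp
qed

lemma degree_power_bounded:
  fixes p :: "'a::comm_semiring_1 poly"
  assumes "degree p \<le> m"
  shows "degree (p ^ k) \<le> m * k"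
  using assms by (meson degree_power_le le_trans mult_le_mono1)

lemma coeff_power_bounded:
  fixes p :: "'a::comm_semiring_1 poly"
  assumes "degree p \<le> m"
  shows "coeff (p ^ k) (m * k) = coeff p m ^ k"
proof (induction k)
  case (Suc k)
  then show ?case
    using coeff_mult_bounded[OF assms degree_power_bounded[OF assms, of k]] by simp
qed simp

lemma degree_mult_bounded:
  fixes p q :: "'a::comm_semiring_1 poly"
  assumes "degree p \<le> m" "degree q \<le> n"
  shows "degree (p * q) \<le> m + n"
  using assms by (meson add_mono degree_mult_le le_trans)

section \<open>Algebraic independence\<close>

lemma UNIV_indet: "(UNIV :: indet set) = {Xi 0, Xi 1, Xi 2, X}"
proof -
  have "i = 0 \<or> i = 1 \<or> i = 2" for i :: 3
  proof (induct i)
    case (of_int z)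
    then have "z = 0 \<or> z = 1 \<or> z = 2"
      by simp arith
    then show ?case
      by auto
  qed
  then have "v \<in> {Xi 0, Xi 1, Xi 2, X}" for v
    by (cases v) auto
  then show ?thesis
    by blast
qed

lemma monom_subst_indet:
  "monom_subst \<sigma> t = \<sigma> (Xi 0) ^ Poly_Mapping.lookup t (Xi 0) * \<sigma> (Xi 1) ^ Poly_Mapping.lookup t (Xi 1) *
    \<sigma> (Xi 2) ^ Poly_Mapping.lookup t (Xi 2) * \<sigma> X ^ Poly_Mapping.lookup t X"
proof -
  have "Poly_Mapping.keys t \<subseteq> {Xi 0, Xi 1, Xi 2, X}"
    using UNIV_indet by blast
  then show ?thesis
    using monom_subst_superset[of "{Xi 0, Xi 1, Xi 2, X}" t \<sigma>] by (simp add: mult.assoc)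
qed

lemma var_power: "var v ^ k = Poly_Mapping.single (Poly_Mapping.single v k) 1"
  by (induction k) (simp_all add: var_def mult_single flip: single_add)

text \<open>The degree in \<open>X\<close> of what \<open>t\<close> becomes when each
  \<open>Xi i\<close> is replaced by \<open>Xi i * X\<close> and \<open>X\<close> by
  \<open>X^2\<close>; \<open>Xi_part t\<close> is the cofactor of that power of
  \<open>X\<close>.\<close>

definition indet_weight :: "(indet \<Rightarrow>\<^sub>0 nat) \<Rightarrow> nat"
  where "indet_weight t = Poly_Mapping.lookup t (Xi 0) + Poly_Mapping.lookup t (Xi 1) +
    Poly_Mapping.lookup t (Xi 2) + 2 * Poly_Mapping.lookup t X"

definition Xi_part :: "(indet \<Rightarrow>\<^sub>0 nat) \<Rightarrow> (indet \<Rightarrow>\<^sub>0 nat)"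
  where "Xi_part t = Poly_Mapping.single (Xi 0) (Poly_Mapping.lookup t (Xi 0)) +
    Poly_Mapping.single (Xi 1) (Poly_Mapping.lookup t (Xi 1)) +
    Poly_Mapping.single (Xi 2) (Poly_Mapping.lookup t (Xi 2))"

lemma lookup_Xi_part:
  "Poly_Mapping.lookup (Xi_part t) (Xi 0) = Poly_Mapping.lookup t (Xi 0)"
  "Poly_Mapping.lookup (Xi_part t) (Xi 1) = Poly_Mapping.lookup t (Xi 1)"
  "Poly_Mapping.lookup (Xi_part t) (Xi 2) = Poly_Mapping.lookup t (Xi 2)"
  by (simp_all add: Xi_part_def lookup_add lookup_single)

lemma indet_monom_eqI:
  assumes "indet_weight s = indet_weight t" "Xi_part s = Xi_part t"
  shows "s = t"
proof (rule poly_mapping_eqI)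
  fix v
  have e: "Poly_Mapping.lookup s (Xi i) = Poly_Mapping.lookup t (Xi i)" if "i \<in> {0, 1, 2}" for i
    using that lookup_Xi_part[of s] lookup_Xi_part[of t] assms(2) by auto
  have "v \<in> {Xi 0, Xi 1, Xi 2, X}"
    using UNIV_indet by blast
  then show "Poly_Mapping.lookup s v = Poly_Mapping.lookup t v"
    using e assms(1) by (auto simp: indet_weight_def)
qed

text \<open>The leading terms in \<open>X\<close> of \<open>\<phi>\<^sub>1\<^sup>(\<^sup>i\<^sup>)\<close> and \<open>\<psi>\<^sub>1\<close> are \<open>X\<^sub>i X\<close> and \<open>X\<^sup>2\<close>, and a monomial in these
  leading terms can be recovered from its degree in \<open>X\<close> and its part in the \<open>X\<^sub>i\<close>.\<close>
lemma of_int_dvd_eval4_leading: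
  fixes P :: "indet int_mpoly" and f0 f1 f2 g :: "indet int_mpoly poly"
  assumes deg: "degree f0 \<le> 1" "degree f1 \<le> 1" "degree f2 \<le> 1" "degree g \<le> 2"
    and lead: "coeff f0 1 = var (Xi 0)" "coeff f1 1 = var (Xi 1)" "coeff f2 1 = var (Xi 2)"
      "coeff g 2 = 1"
    and dvd: "of_int d dvd eval4 P f0 f1 f2 g"
  shows "of_int d dvd P"
proof (rule ccontr)
  let ?\<sigma> = "indet_case4 f0 f1 f2 g"
  let ?B = "{t. \<not> d dvd Poly_Mapping.lookup P t}"
  assume "\<not> of_int d dvd P"
  then have "?B \<noteq> {}"
    by (simp add: of_int_dvd_int_mpoly_iff)
  moreover have "?B \<subseteq> Poly_Mapping.keys P"
    by (auto simp: in_keys_iff)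
  then have finB: "finite ?B"
    by (rule finite_subset) simp
  \<comment> \<open>A monomial of maximal weight among those whose coefficient \<open>d\<close> does
    not divide: its leading term cannot cancel modulo \<open>d\<close>.\<close>
  ultimately obtain s where s: "s \<in> ?B" and max: "\<And>t. t \<in> ?B \<Longrightarrow> indet_weight t \<le> indet_weight s"
    using Max_in[of "indet_weight ` ?B"] Max_ge[of "indet_weight ` ?B"] by fastforce
  have deg_monom: "degree (monom_subst ?\<sigma> t) \<le> indet_weight t"
    and lead_monom: "coeff (monom_subst ?\<sigma> t) (indet_weight t) = Poly_Mapping.single (Xi_part t) 1" for t
  proof -
    let ?a = "Poly_Mapping.lookup t (Xi 0)" and ?b = "Poly_Mapping.lookup t (Xi 1)"
      and ?c = "Poly_Mapping.lookup t (Xi 2)" and ?e = "Poly_Mapping.lookup t X"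
    have eq: "monom_subst ?\<sigma> t = f0 ^ ?a * f1 ^ ?b * f2 ^ ?c * g ^ ?e"
      by (simp add: monom_subst_indet indet_case4_def)
    have w: "indet_weight t = 1 * ?a + 1 * ?b + 1 * ?c + 2 * ?e"
      by (simp add: indet_weight_def)
    show "degree (monom_subst ?\<sigma> t) \<le> indet_weight t"
      unfolding eq w by (intro degree_mult_bounded degree_power_bounded deg)
    have "coeff (monom_subst ?\<sigma> t) (indet_weight t) =
        coeff f0 1 ^ ?a * coeff f1 1 ^ ?b * coeff f2 1 ^ ?c * coeff g 2 ^ ?e"
      unfolding eq w
      by (simp only: coeff_mult_bounded coeff_power_bounded degree_mult_bounded degree_power_bounded deg)
    also have "\<dots> = Poly_Mapping.single (Xi_part t) 1"
      by (simp only: lead var_power mult_single Xi_part_def power_one mult_1_right)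
    finally show "coeff (monom_subst ?\<sigma> t) (indet_weight t) = Poly_Mapping.single (Xi_part t) 1" .
  qed
  \<comment> \<open>At the leading place of \<open>s\<close>, any other \<open>t\<close> contributes
    a multiple of \<open>d\<close>: its coefficient is one, or its degree is too small, or its
    leading monomial is different.\<close>
  have other: "d dvd Poly_Mapping.lookup P t *
      Poly_Mapping.lookup (coeff (monom_subst ?\<sigma> t) (indet_weight s)) (Xi_part s)" if "t \<noteq> s" for t
  proof (cases "t \<in> ?B")
    case True
    consider "indet_weight t < indet_weight s" | "indet_weight t = indet_weight s"
      using max[OF True] by linarith
    then show ?thesis
    proof cases
      case 1
      then show ?thesis
        using deg_monom[of t] by (simp add: coeff_eq_0)
    next
      case 2
      then have "Xi_part t \<noteq> Xi_part s"
        using indet_monom_eqI that by blast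
      then show ?thesis
        by (simp add: lead_monom lookup_single flip: 2)
    qed
  qed simp
  have coeff_of_int: "Poly_Mapping.lookup (coeff (of_int c * q) n) u = c * Poly_Mapping.lookup (coeff q n) u"
    for c n u and q :: "indet int_mpoly poly"
    by (induction c rule: int_induct[of _ 0]) (simp_all add: lookup_add lookup_minus algebra_simps)
  obtain q where "eval4 P f0 f1 f2 g = of_int d * q"
    using dvd ..
  then have "d dvd Poly_Mapping.lookup (coeff (eval4 P f0 f1 f2 g) (indet_weight s)) (Xi_part s)"
    by (simp add: coeff_of_int)
  also have "Poly_Mapping.lookup (coeff (eval4 P f0 f1 f2 g) (indet_weight s)) (Xi_part s) =
      (\<Sum>t\<in>Poly_Mapping.keys P. Poly_Mapping.lookup P t *
        Poly_Mapping.lookup (coeff (monom_subst ?\<sigma> t) (indet_weight s)) (Xi_part s))"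
    by (simp add: eval4_eq mpoly_subst_superset[OF _ order_refl] coeff_sum lookup_sum coeff_of_int)
  also have "\<dots> = Poly_Mapping.lookup P s + (\<Sum>t\<in>Poly_Mapping.keys P - {s}. Poly_Mapping.lookup P t *
        Poly_Mapping.lookup (coeff (monom_subst ?\<sigma> t) (indet_weight s)) (Xi_part s))"
    using s by (subst sum.remove[of _ s]) (auto simp: in_keys_iff lead_monom)
  finally have "d dvd Poly_Mapping.lookup P s"
    by (subst (asm) dvd_add_left_iff) (auto intro!: dvd_sum other)
  with s show False
    by simp
qed

lemma of_int_dvd_eval4_phi_psi:
  fixes P :: "indet int_mpoly"
  assumes "of_int d dvd eval4 P (phi 1 0) (phi 1 1) (phi 1 2) (psi 1)"
  shows "of_int d dvd P"
proof -
  \<comment> \<open>Makes \<open>X\<close> the main variable, over coefficients in the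
    \<open>Xi i\<close>.\<close>
  define \<tau> :: "indet \<Rightarrow> indet int_mpoly poly"
    where "\<tau> v = (case v of Xi i \<Rightarrow> [:var (Xi i):] | X \<Rightarrow> [:0, 1:])" for v
  note hom = mpoly_subst_hom \<tau>_def
  have images:
    "mpoly_subst \<tau> (phi 1 0) = [:var (Xi 1) * var (Xi 2), var (Xi 0):]"
    "mpoly_subst \<tau> (phi 1 1) = [:var (Xi 2) * var (Xi 0), var (Xi 1):]"
    "mpoly_subst \<tau> (phi 1 2) = [:var (Xi 0) * var (Xi 1), var (Xi 2):]"
    "mpoly_subst \<tau> (psi 1) = [:var (Xi 0) ^ 2 + var (Xi 1) ^ 2 + var (Xi 2) ^ 2 - 2,
      var (Xi 0) * var (Xi 1) * var (Xi 2), 1:]"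
    unfolding phi_1 psi_1 by (simp_all add: hom power2_eq_square numeral_poly)
  from assms obtain Q where "eval4 P (phi 1 0) (phi 1 1) (phi 1 2) (psi 1) = of_int d * Q" ..
  then have "mpoly_subst \<tau> (eval4 P (phi 1 0) (phi 1 1) (phi 1 2) (psi 1)) = of_int d * mpoly_subst \<tau> Q"
    by (simp add: mpoly_subst_mult)
  then have "of_int d dvd eval4 P (mpoly_subst \<tau> (phi 1 0)) (mpoly_subst \<tau> (phi 1 1))
      (mpoly_subst \<tau> (phi 1 2)) (mpoly_subst \<tau> (psi 1))"
    by (simp add: mpoly_subst_eval4)
  then show ?thesis
    unfolding images by (rule of_int_dvd_eval4_leading[rotated -1]) (simp_all add: numeral_2_eq_2)
qed

lemma eval4_phi_psi_inject:
  assumes "eval4 P (phi 1 0) (phi 1 1) (phi 1 2) (psi 1) = eval4 Q (phi 1 0) (phi 1 1) (phi 1 2) (psi 1)"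
  shows "P = Q"
  using of_int_dvd_eval4_phi_psi[of 0 "P - Q"] assms by (simp add: eval4_hom)

section \<open>Linear recurrences\<close>

text \<open>For \<open>a = x + 1/x\<close> and \<open>b = y + 1/y\<close>, \<open>w\<close> is the
  power sum of \<open>x y\<close>, \<open>x / y\<close> and their inverses, which are the roots of
  the characteristic polynomial.\<close>

lemma chebT_int_mult_rec:
  fixes a b :: "'a::comm_ring_1"
  defines "w \<equiv> \<lambda>k. chebT_int k a * chebT_int k b"
  shows "w (k + 4) - a * b * w (k + 3) + (a^2 + b^2 - 2) * w (k + 2) - a * b * w (k + 1) + w k = 0"
proof -
  have r: "chebT_int (k + 2) x = x * chebT_int (k + 1) x - chebT_int k x"
    "chebT_int (k + 3) x = x * chebT_int (k + 2) x - chebT_int (k + 1) x"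
    "chebT_int (k + 4) x = x * chebT_int (k + 3) x - chebT_int (k + 2) x" for x :: 'a
    using chebT_int_rec[of k x] chebT_int_rec[of "k + 1" x] chebT_int_rec[of "k + 2" x]
    by (simp_all add: add.assoc)
  show ?thesis
    unfolding w_def r by (simp add: algebra_simps power2_eq_square)
qed

text \<open>The characteristic polynomial of a sum of two sequences is the product of theirs.\<close>
lemma sum_quartic_rec:
  fixes w z :: "int \<Rightarrow> 'a::comm_ring_1"
  assumes w: "\<And>k. w (k + 4) - p * w (k + 3) + s * w (k + 2) - p * w (k + 1) + w k = 0"
    and z: "\<And>k. z (k + 4) - q * z (k + 3) + r * z (k + 2) - q * z (k + 1) + z k = 0"
  defines "v \<equiv> \<lambda>k. w k + z k"
  shows "v (k + 8) = (p + q) * (v (k + 7) + v (k + 1)) - (s + r + p * q) * (v (k + 6) + v (k + 2)) +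
    (p + q + p * r + q * s) * (v (k + 5) + v (k + 3)) - (2 + 2 * p * q + s * r) * v (k + 4) - v k"
proof -
  have step: "x (k + 8) = (p + q) * (x (k + 7) + x (k + 1)) - (s + r + p * q) * (x (k + 6) + x (k + 2)) +
      (p + q + p * r + q * s) * (x (k + 5) + x (k + 3)) - (2 + 2 * p * q + s * r) * x (k + 4) - x k"
    if x: "\<And>k. x (k + 4) - p * x (k + 3) + s * x (k + 2) - p * x (k + 1) + x k = 0"
    for p q r s and x :: "int \<Rightarrow> 'a"
  proof -
    let ?y = "\<lambda>k. x (k + 4) - p * x (k + 3) + s * x (k + 2) - p * x (k + 1) + x k"
    \<comment> \<open>Applies the shift operator of the other quartic to the zero sequence
      \<open>?y\<close>.\<close>
    have "?y (k + 4) - q * ?y (k + 3) + r * ?y (k + 2) - q * ?y (k + 1) + ?y k = 0"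
      unfolding x by simp
    then show ?thesis
      by (simp add: algebra_simps)
  qed
  show ?thesis
    unfolding v_def step[OF w, of q r] step[OF z, of p s] by (simp add: algebra_simps)
qed

text \<open>The coefficients are the elementary symmetric functions of the eight weights. They are
  palindromic because the weights come in inverse pairs.\<close>

lemma cheb_phi_rec:
  fixes a b c d :: "'a::comm_ring_1"
  defines "v \<equiv> \<lambda>k. chebT_int k a * chebT_int k b + chebT_int k c * chebT_int k d"
    and "f0 \<equiv> a * b + c * d" and "f1 \<equiv> a * c + d * b" and "f2 \<equiv> a * d + b * c"
    and "g \<equiv> a^2 - 2 + b^2 + c^2 + d^2 + a * b * c * d"
  shows "v (k + 8) = f0 * (v (k + 7) + v (k + 1)) - (g - 2) * (v (k + 6) + v (k + 2)) +
    (f1 * f2 - f0) * (v (k + 5) + v (k + 3)) - (f1^2 + f2^2 - 2 * g + 2) * v (k + 4) - v k"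
proof -
  have coeffs: "g - 2 = (a^2 + b^2 - 2) + (c^2 + d^2 - 2) + a * b * (c * d)"
    "f1 * f2 - f0 = a * b + c * d + a * b * (c^2 + d^2 - 2) + c * d * (a^2 + b^2 - 2)"
    "f1^2 + f2^2 - 2 * g + 2 = 2 + 2 * (a * b) * (c * d) + (a^2 + b^2 - 2) * (c^2 + d^2 - 2)"
    unfolding f0_def f1_def f2_def g_def by (simp_all add: algebra_simps power2_eq_square)
  show ?thesis
    unfolding coeffs unfolding v_def f0_def
    using sum_quartic_rec[OF chebT_int_mult_rec[where a = a and b = b] chebT_int_mult_rec[where a = c and b = d]] .
qed

section \<open>Existence of the polynomials\<close>

lemma phi_eq_chebT_int:
  "phi n 0 = chebT_int (int n) (var X) * chebT_int (int n) (var (Xi 0)) +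
    chebT_int (int n) (var (Xi 1)) * chebT_int (int n) (var (Xi 2))"
  by (simp add: phi_components chebT_int_of_nat)

text \<open>Initial values for the recurrence: the number of weights, then Newton's identities for
  the power sums of order 2 to 4.\<close>

lemma phi_newton_identities:
  defines "f0 \<equiv> phi 1 0" and "f1 \<equiv> phi 1 1" and "f2 \<equiv> phi 1 2" and "g \<equiv> psi 1"
  shows "phi 0 0 = 8"
    and "phi 2 0 = f0^2 - 2 * (g - 2)"
    and "phi 3 0 = f0 * phi 2 0 - (g - 2) * f0 + 3 * (f1 * f2 - f0)"
    and "phi 4 0 = f0 * phi 3 0 - (g - 2) * phi 2 0 + (f1 * f2 - f0) * f0 - 4 * (f1^2 + f2^2 - 2 * g + 2)"
proof -
  have T: "chebT_at 2 x = x^2 - 2" "chebT_at 3 x = x^3 - 3 * x" "chebT_at 4 x = x^4 - 4 * x^2 + 2"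
    for x :: "indet int_mpoly"
    by (simp_all add: numeral_eq_Suc chebT_at_Suc_Suc algebra_simps)
  show "phi 0 0 = 8"
    by (simp add: phi_components)
  show "phi 2 0 = f0^2 - 2 * (g - 2)"
    unfolding f0_def g_def phi_1 psi_1 by (simp add: phi_components T algebra_simps power2_eq_square)
  show "phi 3 0 = f0 * phi 2 0 - (g - 2) * f0 + 3 * (f1 * f2 - f0)"
    unfolding f0_def f1_def f2_def g_def phi_1 psi_1
    by (simp add: phi_components T algebra_simps power2_eq_square power3_eq_cube)
  show "phi 4 0 = f0 * phi 3 0 - (g - 2) * phi 2 0 + (f1 * f2 - f0) * f0 - 4 * (f1^2 + f2^2 - 2 * g + 2)"
    unfolding f0_def f1_def f2_def g_def phi_1 psi_1
    by (simp add: phi_components T algebra_simps power2_eq_square power3_eq_cube power4_eq_xxxx)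
qed

text \<open>The weights are closed under inversion, so power sums are even in the index and the
  absolute value takes care of negative indices.\<close>

lemma phi_rec:
  assumes "n \<ge> 5"
  defines "f0 \<equiv> phi 1 0" and "f1 \<equiv> phi 1 1" and "f2 \<equiv> phi 1 2" and "g \<equiv> psi 1"
  defines "u \<equiv> \<lambda>k. phi (nat \<bar>int n - k\<bar>) 0"
  shows "phi n 0 = f0 * (u 1 + u 7) - (g - 2) * (u 2 + u 6) + (f1 * f2 - f0) * (u 3 + u 5) -
    (f1^2 + f2^2 - 2 * g + 2) * u 4 - u 8"
proof -
  have u: "u k = chebT_int (int n - k) (var X) * chebT_int (int n - k) (var (Xi 0)) +
      chebT_int (int n - k) (var (Xi 1)) * chebT_int (int n - k) (var (Xi 2))" for k
    by (simp add: u_def phi_components chebT_int_def)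
  have f: "f0 = var X * var (Xi 0) + var (Xi 1) * var (Xi 2)"
    "f1 = var X * var (Xi 1) + var (Xi 2) * var (Xi 0)"
    "f2 = var X * var (Xi 2) + var (Xi 0) * var (Xi 1)"
    "g = var X ^ 2 - 2 + var (Xi 0) ^ 2 + var (Xi 1) ^ 2 + var (Xi 2) ^ 2 +
      var X * var (Xi 0) * var (Xi 1) * var (Xi 2)"
    unfolding f0_def f1_def f2_def g_def by (rule phi_1 psi_1)+
  have shift: "int n - 8 + 8 = int n" "int n - 8 + 7 = int n - 1" "int n - 8 + 1 = int n - 7"
    "int n - 8 + 6 = int n - 2" "int n - 8 + 2 = int n - 6" "int n - 8 + 5 = int n - 3"
    "int n - 8 + 3 = int n - 5" "int n - 8 + 4 = int n - 4"
    by simp_all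
  show ?thesis
    unfolding u f phi_eq_chebT_int
    using cheb_phi_rec[of "int n - 8" "var X" "var (Xi 0)" "var (Xi 1)" "var (Xi 2)"]
    unfolding shift .
qed

lemma ex_eval4_phi: "\<exists>P. eval4 P (phi 1 0) (phi 1 1) (phi 1 2) (psi 1) = phi n 0"
proof -
  let ?E = "\<lambda>P. eval4 P (phi 1 0) (phi 1 1) (phi 1 2) (psi 1)"
  let ?R = "range ?E"
  have closed: "p + q \<in> ?R" "p - q \<in> ?R" "p * q \<in> ?R" if pq: "p \<in> ?R" "q \<in> ?R" for p q
  proof -
    obtain P Q where PQ: "p = ?E P" "q = ?E Q"
      using pq by blast
    show "p + q \<in> ?R"
      by (rule range_eqI[of _ _ "P + Q"]) (simp only: PQ eval4_hom)
    show "p - q \<in> ?R"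
      by (rule range_eqI[of _ _ "P - Q"]) (simp only: PQ eval4_hom)
    show "p * q \<in> ?R"
      by (rule range_eqI[of _ _ "P * Q"]) (simp only: PQ eval4_hom)
  qed
  have power: "p ^ 2 \<in> ?R" if "p \<in> ?R" for p
    using that closed(3) by (simp add: power2_eq_square)
  have numeral: "numeral k \<in> ?R" for k
    by (rule range_eqI[of _ _ "numeral k"]) simp
  have gens: "phi 1 0 \<in> ?R" "phi 1 1 \<in> ?R" "phi 1 2 \<in> ?R" "psi 1 \<in> ?R"
    using rangeI[of ?E "var (Xi 0)"] rangeI[of ?E "var (Xi 1)"] rangeI[of ?E "var (Xi 2)"]
      rangeI[of ?E "var X"] by simp_all
  note ring = closed power numeral gens
  have p0: "phi 0 0 \<in> ?R"
    unfolding phi_newton_identities(1) by (rule numeral)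
  have p2: "phi 2 0 \<in> ?R"
    unfolding phi_newton_identities(2) by (intro ring)
  have p3: "phi 3 0 \<in> ?R"
    unfolding phi_newton_identities(3) by (intro ring p2)
  have p4: "phi 4 0 \<in> ?R"
    unfolding phi_newton_identities(4) by (intro ring p2 p3)
  have "phi n 0 \<in> ?R"
  proof (induction n rule: less_induct)
    case (less n)
    show ?case
    proof (cases "n \<ge> 5")
      case True
      \<comment> \<open>The induction hypothesis applies since \<open>8 - n < n\<close>, which is
        where the bound 5 comes from.\<close>
      have "phi (nat \<bar>int n - k\<bar>) 0 \<in> ?R" if "1 \<le> k" "k \<le> 8" for k
        using that True by (intro less) auto
      then show ?thesis
        unfolding phi_rec[OF True] by (intro ring) auto
    next
      case False
      then consider "n = 0" | "n = 1" | "n = 2" | "n = 3" | "n = 4"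
        by linarith
      then show ?thesis
        by cases (use gens(1) p0 p2 p3 p4 in \<open>simp_all only:\<close>)
    qed
  qed
  then obtain P where "phi n 0 = ?E P"
    by (rule rangeE)
  then show ?thesis
    by (intro exI) (rule sym)
qed

text \<open>This is \<open>p1^2 = p2 + 2 e2\<close> for the \<open>n\<close>th powers of the
  weights: \<open>psi n - 2\<close> is their second elementary symmetric function.\<close>

lemma phi_square: "phi n 0 ^ 2 = phi (2 * n) 0 + 2 * (psi n - 2)"
  unfolding phi_components psi_def chebT_at_double by (simp add: algebra_simps power2_eq_square)

lemma ex_eval4_psi: "\<exists>P. eval4 P (phi 1 0) (phi 1 1) (phi 1 2) (psi 1) = psi n"
proof -
  let ?E = "\<lambda>P. eval4 P (phi 1 0) (phi 1 1) (phi 1 2) (psi 1)"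
  obtain P Q where P: "?E P = phi n 0" and Q: "?E Q = phi (2 * n) 0"
    using ex_eval4_phi by metis
  have E: "?E (P ^ 2 - Q) = 2 * (psi n - 2)"
    by (simp only: eval4_hom P Q phi_square add_diff_cancel_left')
  \<comment> \<open>Independence modulo 2 lifts the factor 2 from the value to the polynomial
    \<open>P ^ 2 - Q\<close> itself.\<close>
  then have "of_int 2 dvd ?E (P ^ 2 - Q)"
    by (simp only: of_int_numeral dvd_triv_left)
  then obtain H where "P ^ 2 - Q = of_int 2 * H"
    using of_int_dvd_eval4_phi_psi by blast
  with E have "2 * ?E H = 2 * (psi n - 2)"
    by (simp add: eval4_hom)
  then have "?E H = psi n - 2"
    using int_mpoly_double_inject by blast
  then have "?E (H + 2) = psi n"
    by (simp add: eval4_hom)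
  then show ?thesis ..
qed

text \<open>Substituting \<open>T\<^sub>m\<close> for every variable turns \<open>\<phi>\<^sub>n\<close> into \<open>\<phi>\<^sub>m\<^sub>n\<close> and \<open>\<psi>\<^sub>n\<close> into \<open>\<psi>\<^sub>m\<^sub>n\<close>, so only
  \<open>m = 1\<close> matters.\<close>
lemma ex1_eval4_all:
  assumes ex: "\<exists>P. eval4 P (phi 1 0) (phi 1 1) (phi 1 2) (psi 1) = q 1"
    and q: "\<And>m. mpoly_subst (\<lambda>v. chebT_at m (var v)) (q 1) = q m"
  shows "\<exists>!P. \<forall>m. eval4 P (phi m 0) (phi m 1) (phi m 2) (psi m) = q m"
proof -
  obtain P where P: "eval4 P (phi 1 0) (phi 1 1) (phi 1 2) (psi 1) = q 1"
    using ex ..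
  have "eval4 P (phi m 0) (phi m 1) (phi m 2) (psi m) = q m" for m
    using mpoly_subst_eval4[of "\<lambda>v. chebT_at m (var v)" P "phi 1 0" "phi 1 1" "phi 1 2" "psi 1"]
    by (simp only: P q mpoly_subst_phi mpoly_subst_psi mult_1_right)
  then show ?thesis
    using eval4_phi_psi_inject by metis
qed

theorem theorem4p5:
  fixes n :: nat
  shows "(\<exists>!\<Phi> :: indet int_mpoly.
            \<forall>m. eval4 \<Phi> (phi m 0) (phi m 1) (phi m 2) (psi m) = phi (m * n) 0) \<and>
         (\<exists>!\<Psi> :: indet int_mpoly.
            \<forall>m. eval4 \<Psi> (phi m 0) (phi m 1) (phi m 2) (psi m) = psi (m * n))"
proof
  show "\<exists>!\<Phi>. \<forall>m. eval4 \<Phi> (phi m 0) (phi m 1) (phi m 2) (psi m) = phi (m * n) 0"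
    by (rule ex1_eval4_all) (simp_all only: mult_1 ex_eval4_phi mpoly_subst_phi)
  show "\<exists>!\<Psi>. \<forall>m. eval4 \<Psi> (phi m 0) (phi m 1) (phi m 2) (psi m) = psi (m * n)"
    by (rule ex1_eval4_all) (simp_all only: mult_1 ex_eval4_psi mpoly_subst_psi)
qed

end
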